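(* Let $P$ and $Q$ be two arbitrary points in $AdS$. Then there is a smooth curve in $AdS$, horizontal with respect to the distribution $\mathcal D=\operatorname{span}\{T,X\}$, joining $P$ and $Q$.
   Context: $\mathbb R^{2,2}$ is $\mathbb R^4$ with $\langle x,y\rangle=-x_1y_1-x_2y_2+x_3y_3+x_4y_4$, and $AdS=\{x\in\mathbb R^4:\langle x,x\rangle=-1\}$, i.e. $-x_1^2-x_2^2+x_3^2+x_4^2=-1$, a smooth 3-dimensional submanifold of $\mathbb R^4$. The vector fields $T(x)=(-x_2,x_1,x_4,-x_3)$, $X(x)=(x_3,x_4,x_1,x_2)$, $Y(x)=(x_4,-x_3,-x_2,x_1)$ form a basis of the tangent space of $AdS$ at each point $x\in AdS$, mutually orthogonal with respect to $\langle\cdot,\cdot\rangle$, with $\langle T,T\rangle=-1$, $\langle X,X\rangle=\langle Y,Y\rangle=1$. A curve $c:[0,1]\to AdS$ is horizontal (with respect to $\mathcal D=\operatorname{span}\{T,X\}$) if $\dot c(s)$ lies in the span of $T(c(s))$ and $X(c(s))$ for (almost) every $s$. *)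

theory Defs
  imports "HOL-Analysis.Analysis"
begin

definition ads_inner :: "real ^ 4 \<Rightarrow> real ^ 4 \<Rightarrow> real" where
  "ads_inner x y = - (x $ 1 * y $ 1) - x $ 2 * y $ 2 + x $ 3 * y $ 3 + x $ 4 * y $ 4"

definition AdS :: "(real ^ 4) set" where
  "AdS = {x. ads_inner x x = - 1}"

definition T_field :: "real ^ 4 \<Rightarrow> real ^ 4" where
  "T_field x = vector [- x $ 2, x $ 1, x $ 4, - x $ 3]"

definition X_field :: "real ^ 4 \<Rightarrow> real ^ 4" where
  "X_field x = vector [x $ 3, x $ 4, x $ 1, x $ 2]"

definition distr :: "real ^ 4 \<Rightarrow> (real ^ 4) set" where
  "distr x = span {T_field x, X_field x}"

text \<open>
  The derivative of a curve on the closed unit interval, one-sided at the endpoints.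
\<close>

definition curve_deriv :: "(real \<Rightarrow> real ^ 4) \<Rightarrow> real \<Rightarrow> real ^ 4" where
  "curve_deriv c s = vector_derivative c (at s within {0..1})"

text \<open>
  Smooth means infinitely differentiable on the closed interval. Since \<open>AdS\<close> is an embedded
  submanifold, a curve in \<open>AdS\<close> is smooth iff it is smooth as a curve in the ambient space.
  The velocity may vanish; in particular constant curves are smooth.
\<close>

definition smooth_curve :: "(real \<Rightarrow> real ^ 4) \<Rightarrow> bool" where
  "smooth_curve c \<longleftrightarrow> (\<forall>n. (curve_deriv ^^ n) c differentiable_on {0..1})"

text \<open>
  For smooth curves, whose velocity is continuous, requiring the condition for all
  parameters is the same as requiring it for almost all of them.
\<close>

definition horizontal :: "(real \<Rightarrow> real ^ 4) \<Rightarrow> bool" where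
  "horizontal c \<longleftrightarrow> (\<forall>s\<in>{0..1}. curve_deriv c s \<in> distr (c s))"

end

theory Submission
  imports Defs
begin

text \<open>
  Put \<open>p = (x\<^sub>1 + x\<^sub>3) + i (x\<^sub>2 - x\<^sub>4)\<close> and \<open>q = (x\<^sub>1 - x\<^sub>3) + i (x\<^sub>2 + x\<^sub>4)\<close>. Then \<open>x \<in> AdS\<close> means
  \<open>Re (p * cnj q) = 1\<close>, so \<open>x\<close> is determined by the point \<open>w = p / q\<close> of the right half plane
  and the angle \<open>\<theta> = arg q\<close>. A curve is horizontal iff \<open>w' = l * cis (- 2 * \<theta>)\<close> for some real
  function \<open>l\<close>, that is, iff \<open>w\<close> moves along the line whose direction is prescribed by \<open>\<theta>\<close>.
  Let \<open>\<theta>\<close> run linearly with speed \<open>m\<close> and take \<open>l = Re (cnj g * cis (- 2 * \<theta>))\<close>; then \<open>w'\<close> is the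
  constant \<open>g / 2\<close> plus a term that oscillates with frequency \<open>4 m\<close>. For \<open>m\<close> large, \<open>g\<close> can be chosen
  so that \<open>w\<close> has the prescribed endpoints, and \<open>w\<close> is so close to a straight segment that
  it stays in the half plane. The value of \<open>\<theta>\<close> at the end is prescribed modulo \<open>2 * pi\<close> only, so
  \<open>m\<close> may be as large as we like.
\<close>

section \<open>Smoothness from families of functions closed under differentiation\<close>

text \<open>By induction every iterated derivative of \<open>c\<close> agrees with a member of
  \<open>F\<close>. The agreement is claimed on \<open>{0..1}\<close> only, since
  \<open>curve_deriv\<close> carries no information at other parameters.\<close>

lemma smooth_curve_if_derivative_closed:
  assumes closed: "\<And>f. f \<in> F \<Longrightarrow> \<exists>f'\<in>F. \<forall>s\<in>{0..1}. (f has_vector_derivative f' s) (at s within {0..1})"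
    and "c \<in> F"
  shows "smooth_curve c"
proof -
  have iter: "\<exists>f\<in>F. \<forall>s\<in>{0..1}. (curve_deriv ^^ n) c s = f s" for n
  proof (induction n)
    case 0
    then show ?case using \<open>c \<in> F\<close> by auto
  next
    case (Suc n)
    then obtain f where f: "f \<in> F" "\<forall>s\<in>{0..1}. (curve_deriv ^^ n) c s = f s" by blast
    from closed[OF f(1)] obtain f' where f': "f' \<in> F"
      "\<forall>s\<in>{0..1}. (f has_vector_derivative f' s) (at s within {0..1})" by blast
    have "(curve_deriv ^^ Suc n) c s = f' s" if s: "s \<in> {0..1}" for s
    proof -
      have "((curve_deriv ^^ n) c has_vector_derivative f' s) (at s within {0..1})"
        using f'(2) f(2) s by (auto intro: has_vector_derivative_transform)
      then have "vector_derivative ((curve_deriv ^^ n) c) (at s within {0..1}) = f' s"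
        using s by (intro vector_derivative_within_closed_interval) auto
      then show ?thesis by (simp add: curve_deriv_def)
    qed
    then show ?case using f'(1) by blast
  qed
  have "(curve_deriv ^^ n) c differentiable_on {0..1}" for n
  proof -
    obtain f where f: "f \<in> F" "\<forall>s\<in>{0..1}. (curve_deriv ^^ n) c s = f s"
      using iter by blast
    from closed[OF f(1)] have "f differentiable_on {0..1}"
      unfolding differentiable_on_def using differentiableI_vector by blast
    then show ?thesis
      using f(2) unfolding differentiable_on_def
      by (metis (no_types, lifting) differentiable_transform_within zero_less_one)
  qed
  then show ?thesis by (simp add: smooth_curve_def)
qed

text \<open>
  All derivatives of the curve are polynomials in finitely many functions, so it is enough to
  differentiate the generators once.
\<close>

inductive_set function_algebra :: "(real \<Rightarrow> real) set \<Rightarrow> (real \<Rightarrow> real) set"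
  for G :: "(real \<Rightarrow> real) set" where
  generator: "g \<in> G \<Longrightarrow> g \<in> function_algebra G"
| const: "(\<lambda>s. a) \<in> function_algebra G"
| add: "f \<in> function_algebra G \<Longrightarrow> g \<in> function_algebra G \<Longrightarrow> (\<lambda>s. f s + g s) \<in> function_algebra G"
| mult: "f \<in> function_algebra G \<Longrightarrow> g \<in> function_algebra G \<Longrightarrow> (\<lambda>s. f s * g s) \<in> function_algebra G"

lemma function_algebra_minus:
  assumes "f \<in> function_algebra G"
  shows "(\<lambda>s. - f s) \<in> function_algebra G"
  using function_algebra.mult[OF function_algebra.const[of "-1"] assms] by simp

lemma function_algebra_diff:
  assumes "f \<in> function_algebra G" "g \<in> function_algebra G"
  shows "(\<lambda>s. f s - g s) \<in> function_algebra G"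
  using function_algebra.add[OF assms(1) function_algebra_minus[OF assms(2)]] by simp

lemmas function_algebra_intros = function_algebra.const function_algebra.add function_algebra.mult
  function_algebra_minus function_algebra_diff

lemma function_algebra_derivative:
  assumes gen: "\<And>g. g \<in> G \<Longrightarrow>
      \<exists>g'\<in>function_algebra G. \<forall>s\<in>I. (g has_real_derivative g' s) (at s within I)"
    and "f \<in> function_algebra G"
  shows "\<exists>f'\<in>function_algebra G. \<forall>s\<in>I. (f has_real_derivative f' s) (at s within I)"
  using assms(2)
proof induction
  case (generator g)
  then show ?case by (rule gen)
next
  case (const a)
  show ?case by (rule bexI[of _ "\<lambda>s. 0"]) (auto intro: function_algebra.const)
next
  case (add f g)
  then obtain f' g' where
    "f' \<in> function_algebra G" "\<forall>s\<in>I. (f has_real_derivative f' s) (at s within I)"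
    "g' \<in> function_algebra G" "\<forall>s\<in>I. (g has_real_derivative g' s) (at s within I)" by blast
  then show ?case
    by (intro bexI[of _ "\<lambda>s. f' s + g' s"]) (auto intro!: function_algebra.add DERIV_add)
next
  case (mult f g)
  then obtain f' g' where
    "f' \<in> function_algebra G" "\<forall>s\<in>I. (f has_real_derivative f' s) (at s within I)"
    "g' \<in> function_algebra G" "\<forall>s\<in>I. (g has_real_derivative g' s) (at s within I)" by blast
  with mult show ?case
    by (intro bexI[of _ "\<lambda>s. f' s * g s + g' s * f s"])
      (auto intro!: function_algebra_intros DERIV_mult)
qed

lemma has_vector_derivative_vecI:
  fixes f :: "real \<Rightarrow> real ^ 'n"
  assumes "\<And>i. ((\<lambda>s. f s $ i) has_real_derivative f' $ i) (at s within I)"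
  shows "(f has_vector_derivative f') (at s within I)"
  unfolding has_vector_derivative_def
proof (subst has_derivative_componentwise_within, intro ballI)
  fix b :: "real ^ 'n" assume "b \<in> Basis"
  then obtain i where b: "b = axis i 1" by (auto simp: Basis_vec_def)
  show "((\<lambda>x. f x \<bullet> b) has_derivative (\<lambda>h. (h *\<^sub>R f') \<bullet> b)) (at s within I)"
    using assms[of i] by (simp add: b inner_axis has_field_derivative_def mult_commute_abs)
qed

lemma vector_4:
  fixes a b c d :: "'a :: zero"
  shows "(vector [a, b, c, d] :: 'a ^ 4) $ 1 = a" "(vector [a, b, c, d] :: 'a ^ 4) $ 2 = b"
    "(vector [a, b, c, d] :: 'a ^ 4) $ 3 = c" "(vector [a, b, c, d] :: 'a ^ 4) $ 4 = d"
  unfolding vector_def by simp_all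

text \<open>The family closed under differentiation consists of the curves whose four components all
  lie in the algebra.\<close>

lemma smooth_curve_if_components:
  assumes gen: "\<And>g. g \<in> G \<Longrightarrow>
      \<exists>g'\<in>function_algebra G. \<forall>s\<in>{0..1}. (g has_real_derivative g' s) (at s within {0..1})"
    and "\<And>i. (\<lambda>s. c s $ i) \<in> function_algebra G"
  shows "smooth_curve c"
proof (rule smooth_curve_if_derivative_closed)
  let ?F = "{f :: real \<Rightarrow> real ^ 4. \<forall>i. (\<lambda>s. f s $ i) \<in> function_algebra G}"
  show "c \<in> ?F" using assms(2) by simp
  fix f assume "f \<in> ?F"
  then have "\<forall>i. \<exists>g\<in>function_algebra G.
      \<forall>s\<in>{0..1}. ((\<lambda>s. f s $ i) has_real_derivative g s) (at s within {0..1})"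
    using function_algebra_derivative[OF gen] by blast
  then obtain d where d: "\<And>i. d i \<in> function_algebra G"
    "\<And>i s. s \<in> {0..1} \<Longrightarrow> ((\<lambda>s. f s $ i) has_real_derivative d i s) (at s within {0..1})"
    by metis
  have "(f has_vector_derivative (\<chi> i. d i s)) (at s within {0..1})" if "s \<in> {0..1}" for s
    using d(2)[OF that] by (intro has_vector_derivative_vecI) simp
  then show "\<exists>f'\<in>?F. \<forall>s\<in>{0..1}. (f has_vector_derivative f' s) (at s within {0..1})"
    using d(1) by (intro bexI[of _ "\<lambda>s. \<chi> i. d i s"]) auto
qed


section \<open>Steering in the right half plane\<close>

text \<open>For \<open>z\<close> of modulus 1,
  \<open>Re (cnj g * z) * z = g / 2 + cnj g * z * z / 2\<close>. With
  \<open>z = cis (- 2 * \<theta>)\<close> the second term has frequency \<open>4 * m\<close>, so the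
  velocity integrates to a linear motion plus an error of order \<open>1 / m\<close>.\<close>

lemma half_plane_path:
  fixes w\<^sub>0 w\<^sub>1 :: complex and \<theta>\<^sub>0 \<theta>\<^sub>1 :: real
  assumes pos: "Re w\<^sub>0 > 0" "Re w\<^sub>1 > 0"
  obtains m g w where
    "cis (\<theta>\<^sub>0 + m) = cis \<theta>\<^sub>1" "w 0 = w\<^sub>0" "w 1 = w\<^sub>1" "\<And>s. s \<in> {0..1} \<Longrightarrow> Re (w s) > 0"
    "\<And>s. (w has_vector_derivative
      of_real (Re (cnj g * cis (- 2 * (\<theta>\<^sub>0 + m * s)))) * cis (- 2 * (\<theta>\<^sub>0 + m * s))) (at s)"
proof -
  define \<Delta> where "\<Delta> = w\<^sub>1 - w\<^sub>0"
  define v where "v = min (Re w\<^sub>0) (Re w\<^sub>1)"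
  have v: "v > 0" using pos by (simp add: v_def)
  \<comment> \<open>The number \<open>k\<close> of extra full turns. The last summand absorbs a
    negative \<open>\<theta>\<^sub>1 - \<theta>\<^sub>0\<close>; the others make the oscillation
    small compared with the distance \<open>v\<close> of the endpoints from the boundary.\<close>
  obtain k :: nat where k: "real k > 1 + 2 * cmod \<Delta> / v + \<bar>\<theta>\<^sub>1 - \<theta>\<^sub>0\<bar>"
    using reals_Archimedean2 by blast
  define m where "m = \<theta>\<^sub>1 - \<theta>\<^sub>0 + 2 * pi * real k"
  have "real k \<le> 2 * pi * real k"
    using pi_gt3 by (simp add: mult_le_cancel_right1)
  then have m: "m > 1 + 2 * cmod \<Delta> / v" using k by (simp add: m_def)
  moreover have "2 * cmod \<Delta> / v \<ge> 0" using v by simp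
  ultimately have m1: "m > 1" by linarith
  have m2: "2 * cmod \<Delta> / m < v"
    using m m1 v by (simp add: field_simps)
  have end_angle: "cis (\<theta>\<^sub>0 + m) = cis \<theta>\<^sub>1"
    by (simp add: m_def cis_mult[symmetric] cis_multiple_2pi)
  \<comment> \<open>The antiderivative of \<open>cis (- 4 * (\<theta>\<^sub>0 + m * s)) / 2\<close>
    that vanishes at 0.\<close>
  define e where "e s = (cis (- 4 * (\<theta>\<^sub>0 + m * s)) - cis (- 4 * \<theta>\<^sub>0)) * (\<i> / (8 * m))" for s
  have e_le: "cmod (e s) \<le> 1 / (4 * m)" for s
  proof -
    have "cmod (e s) \<le> 2 * (1 / (8 * m))"
      unfolding e_def norm_mult
    proof (intro mult_mono)
      show "cmod (cis (- 4 * (\<theta>\<^sub>0 + m * s)) - cis (- 4 * \<theta>\<^sub>0)) \<le> 2"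
        by (rule order_trans[OF norm_triangle_ineq4]) simp
    qed (use m1 in \<open>auto simp: norm_divide norm_mult\<close>)
    then show ?thesis by simp
  qed
  \<comment> \<open>The end condition is \<open>g / 2 + e 1 * cnj g = \<Delta>\<close>. Together
    with its conjugate it is a linear system for \<open>g\<close> and \<open>cnj g\<close> with
    determinant \<open>d\<close>; Cramer's rule gives \<open>g\<close>.\<close>
  define d where "d = 1 / 4 - (cmod (e 1))\<^sup>2"
  define g where "g = (\<Delta> / 2 - e 1 * cnj \<Delta>) / of_real d"
  have e1: "cmod (e 1) \<le> 1 / 4"
    using e_le[of 1] m1 by (elim order_trans) (simp add: field_simps)
  then have "(cmod (e 1))\<^sup>2 \<le> (1 / 4)\<^sup>2" by (intro power_mono) auto
  then have d: "d \<ge> 3 / 16" by (simp add: d_def power2_eq_square)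
  have "g / 2 + e 1 * cnj g = ((\<Delta> / 2 - e 1 * cnj \<Delta>) / 2 + e 1 * (cnj \<Delta> / 2 - cnj (e 1) * \<Delta>)) / of_real d"
    by (simp add: g_def add_divide_distrib)
  also have "\<dots> = \<Delta> * (1 / 4 - e 1 * cnj (e 1)) / of_real d"
    by (simp add: field_simps)
  also have "1 / 4 - e 1 * cnj (e 1) = of_real d"
    by (simp add: d_def complex_norm_square[symmetric])
  finally have g: "g / 2 + e 1 * cnj g = \<Delta>" using d by simp
  have "cmod (\<Delta> / 2 - e 1 * cnj \<Delta>) \<le> cmod \<Delta> / 2 + cmod (e 1) * cmod \<Delta>"
    by (rule order_trans[OF norm_triangle_ineq4]) (simp add: norm_mult norm_divide)
  also have "\<dots> \<le> cmod \<Delta> / 2 + 1 / 4 * cmod \<Delta>"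
    using e1 by (intro add_left_mono mult_right_mono) auto
  finally have "cmod g * d \<le> 3 / 4 * cmod \<Delta>"
    using d by (simp add: g_def norm_divide)
  moreover have "cmod g * (3 / 16) \<le> cmod g * d"
    using d by (intro mult_left_mono) auto
  ultimately have g_le: "cmod g \<le> 4 * cmod \<Delta>" by linarith
  define w where "w s = w\<^sub>0 + of_real s * (g / 2) + cnj g * e s" for s
  have w0: "w 0 = w\<^sub>0" by (simp add: w_def e_def)
  have w1: "w 1 = w\<^sub>1" using g by (simp add: w_def \<Delta>_def algebra_simps)
  have w_pos: "Re (w s) > 0" if s: "s \<in> {0..1}" for s
  proof -
    \<comment> \<open>This is the deviation of \<open>w s\<close> from the segment between the
      endpoints, on which the real part is at least \<open>v\<close>.\<close>
    have "cmod (cnj g * (e s - of_real s * e 1)) \<le> 4 * cmod \<Delta> * (1 / (4 * m) + 1 * (1 / (4 * m)))"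
      unfolding norm_mult complex_mod_cnj
    proof (intro mult_mono g_le order_trans[OF norm_triangle_ineq4] add_mono e_le)
      show "cmod (of_real s * e 1) \<le> 1 * (1 / (4 * m))"
        unfolding norm_mult using s by (intro mult_mono e_le) auto
    qed auto
    also have "\<dots> = 2 * cmod \<Delta> / m" using m1 by (simp add: field_simps)
    finally have small: "cmod (cnj g * (e s - of_real s * e 1)) < v" using m2 by simp
    have "g / 2 = w\<^sub>1 - w\<^sub>0 - e 1 * cnj g" using g by (simp add: \<Delta>_def algebra_simps)
    then have "w s = of_real (1 - s) * w\<^sub>0 + of_real s * w\<^sub>1 + cnj g * (e s - of_real s * e 1)"
      by (simp only: w_def) (simp add: algebra_simps)
    then have "Re (w s) = (1 - s) * Re w\<^sub>0 + s * Re w\<^sub>1 + Re (cnj g * (e s - of_real s * e 1))"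
      by simp
    moreover have "\<bar>Re (cnj g * (e s - of_real s * e 1))\<bar> < v"
      using abs_Re_le_cmod small le_less_trans by blast
    moreover have "(1 - s) * v + s * v \<le> (1 - s) * Re w\<^sub>0 + s * Re w\<^sub>1"
      using s by (intro add_mono mult_left_mono) (auto simp: v_def)
    ultimately show ?thesis by (simp add: algebra_simps)
  qed
  have w_deriv: "(w has_vector_derivative
      of_real (Re (cnj g * cis (- 2 * (\<theta>\<^sub>0 + m * s)))) * cis (- 2 * (\<theta>\<^sub>0 + m * s))) (at s)" for s
  proof -
    define z where "z = cis (- 2 * (\<theta>\<^sub>0 + m * s))"
    have z2: "cis (- 4 * (\<theta>\<^sub>0 + m * s)) = z * z" by (simp add: z_def cis_mult)
    have zz: "cnj z * z = 1" by (simp add: z_def cis_cnj cis_mult)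
    have "(e has_vector_derivative z * z / 2) (at s)"
      unfolding e_def has_vector_derivative_def
      by (rule has_derivative_eq_rhs, (rule derivative_intros)+, rule ext)
        (use m1 z2 in \<open>simp add: scaleR_conv_of_real field_simps\<close>)
    then have "(w has_vector_derivative (0 + g / 2 + cnj g * (z * z / 2))) (at s)"
      unfolding w_def
      by (intro has_vector_derivative_add has_vector_derivative_const has_vector_derivative_mult_right)
        (auto intro!: derivative_eq_intros simp: has_vector_derivative_def scaleR_conv_of_real)
    also have "0 + g / 2 + cnj g * (z * z / 2) = ((cnj g * z + cnj (cnj g * z)) / 2) * z"
      using zz by (simp add: field_simps)
    also have "(cnj g * z + cnj (cnj g * z)) / 2 = of_real (Re (cnj g * z))"
      by (simp add: complex_eq_iff)
    finally show ?thesis by (simp add: z_def)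
  qed
  show ?thesis
    using that[OF end_angle w0 w1 w_pos w_deriv] .
qed

section \<open>Coordinates on \<open>AdS\<close>\<close>

text \<open>Recovers \<open>x\<close> from \<open>w = p / q\<close> and
  \<open>z = q / cmod q\<close>: on \<open>AdS\<close> one has
  \<open>Re w = 1 / (cmod q)\<^sup>2\<close>, so the scalar factor is \<open>cmod q / 2\<close>,
  while \<open>p\<close> and \<open>q\<close> are \<open>w * z\<close> and \<open>z\<close> times
  \<open>cmod q\<close>.\<close>

definition ads_point :: "complex \<Rightarrow> complex \<Rightarrow> real ^ 4" where
  "ads_point z w = (1 / (2 * sqrt (Re w))) *\<^sub>R
    vector [Re (w * z) + Re z, Im (w * z) + Im z, Re (w * z) - Re z, Im z - Im (w * z)]"

text \<open>Up to the squared factor, the quadratic form is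
  \<open>(cmod (w * z - z))\<^sup>2 - (cmod (w * z + z))\<^sup>2\<close>, which equals
  \<open>- 4 * Re w\<close> by polarization.\<close>

lemma ads_point_mem:
  assumes "cmod z = 1" "Re w > 0"
  shows "ads_point z w \<in> AdS"
proof -
  define k where "k = 1 / (2 * sqrt (Re w))"
  have k: "4 * (k\<^sup>2 * Re w) = 1" using assms(2) by (simp add: k_def power_divide power_mult_distrib)
  have z: "(Re z)\<^sup>2 + (Im z)\<^sup>2 = 1"
    using assms(1) by (simp add: cmod_power2[symmetric])
  show ?thesis
    using k z unfolding AdS_def ads_inner_def ads_point_def k_def[symmetric] mem_Collect_eq
      vector_scaleR_component vector_4 times_complex.sel real_scaleR_def
    by algebra
qed

lemma ads_point_surj:
  assumes "x \<in> AdS"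
  obtains \<theta> w where "Re w > 0" "x = ads_point (cis \<theta>) w"
proof -
  define p where "p = Complex (x $ 1 + x $ 3) (x $ 2 - x $ 4)"
  define q where "q = Complex (x $ 1 - x $ 3) (x $ 2 + x $ 4)"
  define w where "w = p / q"
  have pq: "Re p * Re q + Im p * Im q = 1"
    using assms unfolding p_def q_def AdS_def ads_inner_def by (simp add: algebra_simps)
  then have q: "q \<noteq> 0" by auto
  have w: "Re w = 1 / (cmod q)\<^sup>2"
    using pq by (simp add: w_def Re_divide cmod_power2)
  define r z where "r = cmod q" and "z = cis (Arg q)"
  have "q = of_real r * z"
    unfolding r_def z_def by (metis rcis_cmod_Arg rcis_def)
  moreover from this have "p = of_real r * (w * z)"
    using q by (simp add: w_def field_simps)
  moreover have "1 / (2 * sqrt (Re w)) = r / 2"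
    by (simp add: w r_def real_sqrt_divide)
  then have "ads_point z w = (r / 2) *\<^sub>R
      vector [Re (w * z) + Re z, Im (w * z) + Im z, Re (w * z) - Re z, Im z - Im (w * z)]"
    by (simp only: ads_point_def)
  ultimately have "ads_point z w =
      (1 / 2) *\<^sub>R vector [Re p + Re q, Im p + Im q, Re p - Re q, Im q - Im p]"
    by (simp add: vec_eq_iff forall_4 vector_4 algebra_simps)
  also have "\<dots> = x"
    by (simp add: vec_eq_iff forall_4 vector_4 p_def q_def)
  finally show ?thesis
    using that[of w "Arg q"] w q by (simp add: z_def)
qed

section \<open>Horizontality and smoothness of the lifted curve\<close>

text \<open>The pointwise algebra behind horizontality: primed letters are plain reals, standing for
  derivatives when \<open>w' = 2 * b * V * cis (- 2 * \<theta>)\<close> and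
  \<open>\<theta>' = m\<close>. The left side is the product rule applied to
  \<open>ads_point\<close>, and its component along the third field \<open>Y\<close>
  vanishes.\<close>

lemma velocity_horizontal:
  fixes C S V U K m b :: real
  assumes "C\<^sup>2 + S\<^sup>2 = 1"
  defines "x \<equiv> vector [K * (V * C - U * S + C), K * (V * S + U * C + S),
    K * (V * C - U * S - C), K * (S - (V * S + U * C))] :: real ^ 4"
  defines "K' \<equiv> - (b * (C\<^sup>2 - S\<^sup>2) * K)" and "V' \<equiv> 2 * b * V * (C\<^sup>2 - S\<^sup>2)"
    and "U' \<equiv> - (2 * b * V * (2 * S * C))" and "C' \<equiv> - (m * S)" and "S' \<equiv> m * C"
  shows "(vector [K' * (V * C - U * S + C) + K * (V' * C + V * C' - (U' * S + U * S') + C'),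
    K' * (V * S + U * C + S) + K * (V' * S + V * S' + (U' * C + U * C') + S'),
    K' * (V * C - U * S - C) + K * (V' * C + V * C' - (U' * S + U * S') - C'),
    K' * (S - (V * S + U * C)) + K * (S' - (V' * S + V * S' + (U' * C + U * C')))] :: real ^ 4)
    = (m - b * (2 * S * C)) *\<^sub>R T_field x + b *\<^sub>R X_field x"
  unfolding vec_eq_iff forall_4 vector_add_component vector_scaleR_component
    T_field_def X_field_def x_def vector_4 real_scaleR_def K'_def V'_def U'_def C'_def S'_def
  using assms(1) by (intro conjI; algebra)

text \<open>Cosine and sine of the angle, the two parts of \<open>w\<close> and the scalar factor
  \<open>K\<close> generate an algebra closed under differentiation, which gives smoothness;
  \<open>velocity_horizontal\<close> gives the rest.\<close>

lemma horizontal_lift: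
  fixes \<theta> m :: real and g :: complex and w :: "real \<Rightarrow> complex"
  assumes pos: "\<And>s. s \<in> {0..1} \<Longrightarrow> Re (w s) > 0"
    and deriv: "\<And>s. (w has_vector_derivative
      of_real (Re (cnj g * cis (- 2 * (\<theta> + m * s)))) * cis (- 2 * (\<theta> + m * s))) (at s)"
  defines "c \<equiv> \<lambda>s. ads_point (cis (\<theta> + m * s)) (w s)"
  shows "smooth_curve c" "horizontal c"
proof -
  define C where "C = (\<lambda>s. cos (\<theta> + m * s))"
  define S where "S = (\<lambda>s. sin (\<theta> + m * s))"
  define V where "V = (\<lambda>s. Re (w s))"
  define U where "U = (\<lambda>s. Im (w s))"
  define K where "K = (\<lambda>s. 1 / (2 * sqrt (V s)))"
  \<comment> \<open>The speed \<open>Re (cnj g * cis (- 2 * (\<theta> + m * s)))\<close>, expanded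
    by double angles into a polynomial in \<open>C\<close> and \<open>S\<close>.\<close>
  define l where "l = (\<lambda>s. Re g * (C s * C s - S s * S s) - Im g * (2 * S s * C s))"
  have CS: "(C s)\<^sup>2 + (S s)\<^sup>2 = 1" for s by (simp add: C_def S_def)
  have cis2: "cis (- 2 * (\<theta> + m * s)) = Complex (C s * C s - S s * S s) (- (2 * S s * C s))" for s
  proof -
    have "cis (- 2 * (\<theta> + m * s)) = cnj (cis (\<theta> + m * s)) * cnj (cis (\<theta> + m * s))"
      by (simp add: cis_cnj cis_mult)
    then show ?thesis by (simp add: complex_eq_iff C_def S_def)
  qed
  have w': "(w has_vector_derivative
      Complex (l s * (C s * C s - S s * S s)) (- (l s * (2 * S s * C s)))) (at s)" for s
  proof (rule has_vector_derivative_eq_rhs[OF deriv[of s, unfolded cis2]])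
  qed (simp add: l_def complex_eq_iff algebra_simps)
  define V' where "V' = (\<lambda>s. l s * (C s * C s - S s * S s))"
  define U' where "U' = (\<lambda>s. - (l s * (2 * S s * C s)))"
  define C' where "C' = (\<lambda>s. - (m * S s))"
  define S' where "S' = (\<lambda>s. m * C s)"
  \<comment> \<open>Since \<open>K\<close> is half of \<open>V\<close> to the power -1/2, its
    derivative is \<open>- 2 * V' * K^3\<close>: again a polynomial, with no division by
    \<open>V\<close>.\<close>
  define K' where "K' = (\<lambda>s. - (2 * V' s * (K s * (K s * K s))))"
  have dV: "(V has_real_derivative V' s) (at s within {0..1})" for s
    using bounded_linear.has_vector_derivative[OF bounded_linear_Re w'[of s]]
    by (auto simp: V_def V'_def has_real_derivative_iff_has_vector_derivative
        intro: has_vector_derivative_at_within)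
  have dU: "(U has_real_derivative U' s) (at s within {0..1})" for s
    using bounded_linear.has_vector_derivative[OF bounded_linear_Im w'[of s]]
    by (auto simp: U_def U'_def has_real_derivative_iff_has_vector_derivative
        intro: has_vector_derivative_at_within)
  have dC: "(C has_real_derivative C' s) (at s within {0..1})" for s
    unfolding C_def C'_def S_def by (auto intro!: derivative_eq_intros)
  have dS: "(S has_real_derivative S' s) (at s within {0..1})" for s
    unfolding S_def S'_def C_def by (auto intro!: derivative_eq_intros)
  have V_pos: "V s > 0" if "s \<in> {0..1}" for s using pos that by (simp add: V_def)
  have KV: "4 * ((K s)\<^sup>2 * V s) = 1" if "s \<in> {0..1}" for s
    using V_pos[OF that] by (simp add: K_def power_divide power_mult_distrib)
  have dK: "(K has_real_derivative K' s) (at s within {0..1})" if s: "s \<in> {0..1}" for s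
    unfolding K_def K'_def using V_pos[OF s]
    by (auto intro!: derivative_eq_intros dV simp: field_simps)
  define G where "G = {C, S, V, U, K}"
  have G: "C \<in> function_algebra G" "S \<in> function_algebra G" "V \<in> function_algebra G"
    "U \<in> function_algebra G" "K \<in> function_algebra G"
    by (auto simp: G_def intro: function_algebra.generator)
  have l: "l \<in> function_algebra G"
    unfolding l_def by (intro function_algebra_intros G)
  have V'_alg: "V' \<in> function_algebra G"
    unfolding V'_def by (intro function_algebra_intros G l)
  have G': "U' \<in> function_algebra G" "C' \<in> function_algebra G"
    "S' \<in> function_algebra G" "K' \<in> function_algebra G"
    unfolding U'_def C'_def S'_def K'_def by (intro function_algebra_intros G l V'_alg)+
  define d :: "real \<Rightarrow> real ^ 4" where "d s = vector [
    K' s * (V s * C s - U s * S s + C s) + K s * (V' s * C s + V s * C' s - (U' s * S s + U s * S' s) + C' s),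
    K' s * (V s * S s + U s * C s + S s) + K s * (V' s * S s + V s * S' s + (U' s * C s + U s * C' s) + S' s),
    K' s * (V s * C s - U s * S s - C s) + K s * (V' s * C s + V s * C' s - (U' s * S s + U s * S' s) - C' s),
    K' s * (S s - (V s * S s + U s * C s)) + K s * (S' s - (V' s * S s + V s * S' s + (U' s * C s + U s * C' s)))]" for s
  have c: "c s = vector [K s * (V s * C s - U s * S s + C s), K s * (V s * S s + U s * C s + S s),
      K s * (V s * C s - U s * S s - C s), K s * (S s - (V s * S s + U s * C s))]" for s
    by (simp add: c_def ads_point_def vec_eq_iff forall_4 vector_4 K_def V_def U_def C_def S_def)
  show "smooth_curve c"
  proof (rule smooth_curve_if_components)
    fix f assume "f \<in> G"
    then show "\<exists>f'\<in>function_algebra G. \<forall>s\<in>{0..1}. (f has_real_derivative f' s) (at s within {0..1})"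
      using G' V'_alg dC dS dV dU dK unfolding G_def by blast
  next
    have "\<forall>i. (\<lambda>s. c s $ i) \<in> function_algebra G"
      unfolding c forall_4 vector_4 by (intro conjI function_algebra_intros G)
    then show "(\<lambda>s. c s $ i) \<in> function_algebra G" for i by blast
  qed
  show "horizontal c"
    unfolding horizontal_def
  proof
    fix s :: real assume s: "s \<in> {0..1}"
    have "\<forall>i. ((\<lambda>s. c s $ i) has_real_derivative d s $ i) (at s within {0..1})"
      unfolding c d_def forall_4 vector_4
      by (auto intro!: derivative_eq_intros dC dS dV dU dK[OF s] simp: algebra_simps)
    then have "(c has_vector_derivative d s) (at s within {0..1})"
      by (intro has_vector_derivative_vecI) blast
    then have "curve_deriv c s = d s"
      unfolding curve_deriv_def using s by (intro vector_derivative_within_closed_interval) auto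
    moreover
    \<comment> \<open>This is \<open>l / (2 * V)\<close> in disguise, because
      \<open>4 * K\<^sup>2 * V = 1\<close>; it is the coefficient of the velocity along
      \<open>X_field\<close>.\<close>
    define b where "b = 2 * l s * (K s)\<^sup>2"
    have lb: "l s = 2 * b * V s" using KV[OF s] unfolding b_def by algebra
    have "K' s = - (b * ((C s)\<^sup>2 - (S s)\<^sup>2) * K s)"
      by (simp add: K'_def V'_def b_def power2_eq_square algebra_simps)
    moreover have "V' s = 2 * b * V s * ((C s)\<^sup>2 - (S s)\<^sup>2)"
      by (simp add: V'_def lb power2_eq_square)
    moreover have "U' s = - (2 * b * V s * (2 * S s * C s))"
      by (simp add: U'_def lb)
    ultimately have "curve_deriv c s = (m - b * (2 * S s * C s)) *\<^sub>R T_field (c s) + b *\<^sub>R X_field (c s)"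
      using velocity_horizontal[OF CS[of s], where K = "K s" and V = "V s" and U = "U s" and b = b and m = m]
      by (simp only: d_def c C'_def S'_def)
    then show "curve_deriv c s \<in> distr (c s)"
      unfolding distr_def by (simp only:) (intro span_add span_scale span_base; simp)
  qed
qed

theorem theorem1:
  fixes P Q :: "real ^ 4"
  assumes "P \<in> AdS" and "Q \<in> AdS"
  shows "\<exists>c :: real \<Rightarrow> real ^ 4.
    smooth_curve c \<and> (\<forall>s\<in>{0..1}. c s \<in> AdS) \<and> horizontal c \<and> c 0 = P \<and> c 1 = Q"
proof -
  obtain \<theta>\<^sub>0 w\<^sub>0 where P: "Re w\<^sub>0 > 0" "P = ads_point (cis \<theta>\<^sub>0) w\<^sub>0"
    using ads_point_surj[OF assms(1)] .
  obtain \<theta>\<^sub>1 w\<^sub>1 where Q: "Re w\<^sub>1 > 0" "Q = ads_point (cis \<theta>\<^sub>1) w\<^sub>1"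
    using ads_point_surj[OF assms(2)] .
  obtain m g w where w: "cis (\<theta>\<^sub>0 + m) = cis \<theta>\<^sub>1" "w 0 = w\<^sub>0" "w 1 = w\<^sub>1"
    "\<And>s. s \<in> {0..1} \<Longrightarrow> Re (w s) > 0"
    "\<And>s. (w has_vector_derivative of_real (Re (cnj g * cis (- 2 * (\<theta>\<^sub>0 + m * s)))) * cis (- 2 * (\<theta>\<^sub>0 + m * s))) (at s)"
    using half_plane_path[OF P(1) Q(1), of \<theta>\<^sub>0 \<theta>\<^sub>1] by metis
  define c where "c = (\<lambda>s. ads_point (cis (\<theta>\<^sub>0 + m * s)) (w s))"
  have "smooth_curve c" "horizontal c"
    unfolding c_def using horizontal_lift[OF w(4,5)] by auto
  moreover have "\<forall>s\<in>{0..1}. c s \<in> AdS"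
    unfolding c_def using w(4) by (intro ballI ads_point_mem) auto
  moreover have "c 0 = P" "c 1 = Q"
    using w(1-3) P(2) Q(2) by (simp_all add: c_def)
  ultimately show ?thesis by blast
qed

end
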